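(* Let the functions $\alpha_k(s)$ ($k=0,1,2,\ldots$, $s\in\mathbb{C}$) be defined by the Taylor expansion $$\left(\frac{-\log(1-t)}{t}\right)^{s-1}=\sum_{k=0}^\infty \alpha_k(s)\,t^k,\qquad |t|<1.$$ Then for every integer $k\ge 1$, $\alpha_k(s)/(s-1)$ is a polynomial in $s$ with positive rational coefficients, and for every $s\in\mathbb{C}$, $\alpha_k(s)$ satisfies $$|\alpha_k(s)|\le c_s\,\frac{(1+\log(k+1))^{|s|+1}}{k+1},$$ where $$c_s=\frac{|s-1|}{|s|+1}\,(|s|+2)\,2^{|s|+1}.$$
   Context: For $|t|<1$ let $g(t)=\frac{-\log(1-t)}{t}=\sum_{k=0}^\infty \frac{t^k}{k+1}$ (so $g(0)=1$), which is analytic and non-vanishing on $|t|<1$. For $s\in\mathbb{C}$, $g(t)^{s-1}=\exp((s-1)\log g(t))$ with the branch of $\log g$ that is analytic on $|t|<1$ with $\log g(0)=0$. The coefficients $\alpha_k(s)$ are the Taylor coefficients of $g(t)^{s-1}$ at $t=0$; e.g. $\alpha_0(s)=1$, $\alpha_1(s)=(s-1)/2$. *)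

theory Defs
  imports "HOL-Complex_Analysis.Complex_Analysis" "HOL-Computational_Algebra.Polynomial"
begin

text \<open>
  On the open unit disc \<open>1 - t\<close> has positive real part, so the principal logarithm
  \<open>Ln\<close> is the branch of \<open>log (1 - t)\<close> vanishing at \<open>t = 0\<close>.
\<close>

definition log_quot :: "complex \<Rightarrow> complex" where
  "log_quot t = (if t = 0 then 1 else - Ln (1 - t) / t)"

definition is_log_branch :: "(complex \<Rightarrow> complex) \<Rightarrow> bool" where
  "is_log_branch L \<longleftrightarrow> L holomorphic_on ball 0 1 \<and> L 0 = 0 \<and> (\<forall>t\<in>ball 0 1. exp (L t) = log_quot t)"

text \<open>
  The conditions in \<^const>\<open>is_log_branch\<close> determine \<open>L\<close> on the unit disc only; existence and
  uniqueness there are shown below.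
\<close>

definition log_branch :: "complex \<Rightarrow> complex" where
  "log_branch = (SOME L. is_log_branch L)"

definition log_quot_pow :: "complex \<Rightarrow> complex \<Rightarrow> complex" where
  "log_quot_pow s t = exp ((s - 1) * log_branch t)"

definition alpha :: "nat \<Rightarrow> complex \<Rightarrow> complex" where
  "alpha k s = (deriv ^^ k) (log_quot_pow s) 0 / fact k"

definition c_bound :: "complex \<Rightarrow> real" where
  "c_bound s = norm (s - 1) / (norm s + 1) * (norm s + 2) * 2 powr (norm s + 1)"

lemma log_quot_holomorphic: "log_quot holomorphic_on ball 0 1"
proof -
  have Re: "1 - z \<notin> \<real>\<^sub>\<le>\<^sub>0" if "z \<in> ball 0 1" for z :: complex
  proof -
    have "Re z < 1"
      using that complex_Re_le_cmod[of z] by simp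
    then show ?thesis
      by (auto simp: complex_nonpos_Reals_iff)
  qed
  have hol: "(\<lambda>z. - Ln (1 - z)) holomorphic_on ball 0 1"
    using Re by (intro holomorphic_intros) auto
  have "((\<lambda>z. - Ln (1 - z)) has_field_derivative 1) (at 0)"
    by (auto intro!: derivative_eq_intros)
  then have d: "deriv (\<lambda>z. - Ln (1 - z)) 0 = 1"
    by (rule DERIV_imp_deriv)
  have "(\<lambda>z. if z = 0 then deriv (\<lambda>z. - Ln (1 - z)) 0
             else (- Ln (1 - z) - (- Ln (1 - 0))) / (z - 0)) holomorphic_on ball 0 1"
    by (rule pole_lemma_open [OF hol]) auto
  then show ?thesis
    by (rule holomorphic_transform) (simp add: d log_quot_def)
qed

lemma log_quot_nonzero:
  assumes "t \<in> ball 0 1"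
  shows "log_quot t \<noteq> 0"
proof (cases "t = 0")
  case False
  have "exp (Ln (1 - t)) = 1 - t"
    using assms by (intro exp_Ln) auto
  then have "Ln (1 - t) \<noteq> 0"
    using False by auto
  then show ?thesis
    using False by (simp add: log_quot_def)
qed (simp add: log_quot_def)

lemma is_log_branch_exists: "\<exists>L. is_log_branch L"
proof -
  obtain L where L: "L holomorphic_on ball 0 1" "\<And>t. t \<in> ball 0 1 \<Longrightarrow> log_quot t = exp (L t)"
    using contractible_imp_holomorphic_log[OF log_quot_holomorphic convex_imp_contractible[OF convex_ball] log_quot_nonzero]
    by blast
  have e: "exp (L 0) = 1"
    using L(2)[of 0] by (simp add: log_quot_def)
  have "is_log_branch (\<lambda>t. L t - L 0)"
    unfolding is_log_branch_def
  proof (intro conjI ballI)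
    show "(\<lambda>t. L t - L 0) holomorphic_on ball 0 1"
      by (intro holomorphic_intros L)
    show "exp (L t - L 0) = log_quot t" if "t \<in> ball 0 1" for t
      using L(2)[OF that] e by (simp add: exp_diff)
  qed simp
  then show ?thesis by blast
qed

lemma is_log_branch_log_branch: "is_log_branch log_branch"
  unfolding log_branch_def by (rule someI_ex[OF is_log_branch_exists])

lemma is_log_branch_unique:
  assumes L: "is_log_branch L" and M: "is_log_branch M" and t: "t \<in> ball 0 1"
  shows "L t = M t"
proof -
  define D where "D = (\<lambda>t. L t - M t)"
  have D: "D holomorphic_on ball 0 1" "D 0 = 0"
    using L M by (auto simp: D_def is_log_branch_def intro: holomorphic_on_diff)
  have D_exp: "exp (D t) = 1" if "t \<in> ball 0 1" for t
    using L M log_quot_nonzero[OF that] that by (simp add: D_def is_log_branch_def exp_diff)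
  have "(D has_field_derivative 0) (at x)" if x: "x \<in> ball 0 1" for x
  proof -
    have d: "(D has_field_derivative deriv D x) (at x)"
      using D(1) x by (simp add: holomorphic_derivI)
    have "((\<lambda>t. exp (D t)) has_field_derivative (exp (D x) * deriv D x)) (at x)"
      using DERIV_chain[OF DERIV_exp d] by (simp add: o_def)
    moreover have "((\<lambda>t. exp (D t)) has_field_derivative 0) (at x)"
      by (rule has_field_derivative_transform_within_open[of "\<lambda>_. 1" _ _ "ball 0 1"])
         (use D_exp x in auto)
    ultimately have "deriv D x = 0"
      using DERIV_unique by fastforce
    with d show ?thesis by simp
  qed
  then have "D constant_on ball 0 1"
    by (intro has_field_derivative_0_imp_constant_on) auto
  then have "D t = D 0"
    using t by (auto simp: constant_on_def)
  then show ?thesis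
    using D(2) by (simp add: D_def)
qed

lemma alpha_taylor_expansion:
  assumes "norm t < 1"
  shows "(\<lambda>k. alpha k s * t ^ k) sums log_quot_pow s t"
proof -
  have "log_quot_pow s holomorphic_on ball 0 1"
    unfolding log_quot_pow_def using is_log_branch_log_branch
    by (intro holomorphic_intros) (simp add: is_log_branch_def)
  from holomorphic_power_series[OF this, of t] assms show ?thesis
    by (simp add: alpha_def)
qed

end

theory Submission
  imports Defs
begin

text \<open>
  Write \<open>A\<^sub>s = \<Sum> \<alpha>\<^sub>k(s) t\<^sup>k = g\<^sup>s\<^sup>-\<^sup>1\<close>. Differentiating gives
  \<open>A\<^sub>s' = (s - 1) g\<^sup>s\<^sup>-\<^sup>2 g' = (s - 1) A\<^sub>s\<^sub>+\<^sub>1 D\<close> with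
  \<open>D = g' / g\<^sup>2 = - (1 / g)'\<close>, so that
  \<open>k \<alpha>\<^sub>k(s) / (s - 1) = \<Sum>\<^sub>j\<^sub><\<^sub>k D\<^sub>k\<^sub>-\<^sub>1\<^sub>-\<^sub>j \<alpha>\<^sub>j(s + 1)\<close>.
  Everything about signs rests on \<open>D\<close> having positive coefficients. These are, up to the factors
  from the derivative, the absolute values of the Gregory coefficients, and they are positive by a
  theorem of Kaluza: the reciprocal of a power series with positive, strictly log-convex
  coefficients, such as \<open>1 / (n + 1)\<close>, has negative coefficients except for the constant one
  (lemma \<open>inverse_fps_nth_neg_of_log_convex\<close>). Then \<open>g' / g = D g\<close> has positive coefficients as
  well, and the recurrence read off from \<open>A\<^sub>s\<^sub>+\<^sub>1' = s A\<^sub>s\<^sub>+\<^sub>1 (D g)\<close> shows by induction that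
  \<open>\<alpha>\<^sub>j(s + 1)\<close> is a polynomial in \<open>s\<close> of degree \<open>j\<close> with nonnegative rational coefficients and
  positive leading coefficient. In \<open>p\<^sub>k(s) = \<alpha>\<^sub>k(s) / (s - 1)\<close> the power \<open>s\<^sup>i\<close> therefore
  receives a positive contribution from \<open>j = i\<close>, for every \<open>i < k\<close>.

  For the estimate, positivity reduces complex parameters to real ones: with \<open>x = |s|\<close>,
  \<open>|p\<^sub>k(s)| \<le> p\<^sub>k(x) \<le> p\<^sub>k(x + 2) = \<alpha>\<^sub>k(x + 2) / (x + 1)\<close>. The point of passing to
  \<open>x + 2\<close> is that for \<open>y = x + 1 \<ge> 1\<close> all \<open>\<alpha>\<^sub>j(y)\<close> are nonnegative. The coefficients
  of \<open>(t g\<^sup>y)' = g\<^sup>y\<^sup>-\<^sup>1 (g + y t g')\<close> give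
  \<open>(k + 1) \<alpha>\<^sub>k(y + 1) \<le> y \<Sum>\<^sub>j\<^sub>\<le>\<^sub>k \<alpha>\<^sub>j(y)\<close>, because the coefficients
  \<open>(1 + y m) / (m + 1)\<close> of \<open>g + y t g'\<close> are at most \<open>y\<close>. The partial sum is at most
  \<open>r\<^sup>-\<^sup>k g(r)\<^sup>y\<^sup>-\<^sup>1\<close> for each \<open>0 < r < 1\<close>, and \<open>r = k / (k + 1)\<close> makes
  \<open>g(r) \<le> 2 log (k + 1)\<close> while \<open>r\<^sup>-\<^sup>k \<le> e \<le> 2 (1 + log (k + 1))\<close>.
\<close>

section \<open>Reciprocals of power series with log-convex coefficients\<close>

text \<open>
  Kaluza's theorem. Log-convexity says that the ratios \<open>u (n + 1) / u n\<close> increase. Let \<open>v\<close> be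
  the coefficients of the reciprocal. Eliminating \<open>v 0\<close> between the convolution identities
  \<open>\<Sum> v i * u (n - i) = 0\<close> at \<open>n\<close> and at \<open>n - 1\<close> writes \<open>v n\<close> as a combination of
  the earlier \<open>v i\<close> with \<open>i \<ge> 1\<close>, whose weights are differences of two such ratios and hence
  positive. The elimination uses the identity at \<open>n - 1\<close>, which has the right-hand side \<open>0\<close> only
  for \<open>n \<ge> 2\<close>, so that \<open>n = 1\<close> is treated separately.
\<close>

lemma inverse_fps_nth_neg_of_log_convex:
  fixes u :: "nat \<Rightarrow> 'a :: linordered_field"
  assumes pos: "\<And>n. u n > 0"
    and log_convex: "\<And>n. u (Suc n) * u (Suc n) < u n * u (Suc (Suc n))"
    and n: "n > 0"
  shows "fps_nth (inverse (Abs_fps u)) n < 0"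
proof -
  define v where "v = fps_nth (inverse (Abs_fps u))"
  have u0: "u 0 \<noteq> 0"
    using pos[of 0] by simp
  have v0: "v 0 = 1 / u 0"
    by (simp add: v_def divide_inverse)
  have ratio: "u (Suc i) * u j < u i * u (Suc j)" if "i < j" for i j
  proof -
    have "u (Suc n) / u n < u (Suc (Suc n)) / u (Suc n)" for n
      using log_convex[of n] pos[of n] pos[of "Suc n"] by (simp add: field_simps)
    then have "u (Suc i) / u i < u (Suc j) / u j"
      using that by (rule lift_Suc_mono_less)
    then show ?thesis
      using pos[of i] pos[of j] by (simp add: field_simps)
  qed
  have conv: "v 0 * u (Suc m) + (\<Sum>i=1..Suc m. v i * u (Suc m - i)) = 0" for m
  proof -
    have "inverse (Abs_fps u) * Abs_fps u = 1"
      using u0 by (intro inverse_mult_eq_1) simp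
    from arg_cong[OF this, of "\<lambda>F. fps_nth F (Suc m)"]
    have "(\<Sum>i=0..Suc m. v i * u (Suc m - i)) = 0"
      unfolding fps_mult_nth by (simp add: v_def)
    then show ?thesis
      by (simp add: sum.atLeast_Suc_atMost)
  qed
  have "v n < 0"
    using n
  proof (induction n rule: less_induct)
    case (less n)
    then obtain m where m: "n = Suc m"
      using gr0_conv_Suc by blast
    show ?case
    proof (cases m)
      case 0
      have "v 1 * u 0 = - (v 0 * u 1)"
        using conv[of 0] by (simp add: eq_neg_iff_add_eq_0 add.commute)
      also have "\<dots> < 0"
        using pos by (simp add: v0)
      finally show ?thesis
        using pos[of 0] by (simp add: m 0 mult_less_0_iff)
    next
      case (Suc l)
      \<comment> \<open>The factor \<open>u m\<close> clears the denominator of the ratio \<open>u n / u m\<close> in the elimination.\<close>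
      have "v n * u 0 * u m = - (v 0 * u n * u m) - (\<Sum>i=1..m. v i * u (n - i)) * u m"
      proof -
        have "v n * u 0 = - (v 0 * u n) - (\<Sum>i=1..m. v i * u (n - i))"
          using conv[of m] by (simp add: m algebra_simps eq_neg_iff_add_eq_0)
        from arg_cong[OF this, of "\<lambda>x. x * u m"] show ?thesis
          by (simp add: left_diff_distrib)
      qed
      also have "v 0 * u n * u m = - (\<Sum>i=1..m. v i * u (m - i)) * u n"
      proof -
        have "v 0 * u m = - (\<Sum>i=1..m. v i * u (m - i))"
          using conv[of l] by (simp add: Suc eq_neg_iff_add_eq_0)
        from arg_cong[OF this, of "\<lambda>x. x * u n"] show ?thesis
          by (simp only: mult_ac)
      qed
      also have "- (- (\<Sum>i=1..m. v i * u (m - i)) * u n) - (\<Sum>i=1..m. v i * u (n - i)) * u m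
          = (\<Sum>i=1..m. v i * (u (m - i) * u n - u (n - i) * u m))"
        by (simp add: sum_distrib_left sum_subtractf algebra_simps)
      also have "\<dots> < 0"
      proof -
        have "v i * (u (m - i) * u n - u (n - i) * u m) < 0" if "i \<in> {1..m}" for i
        proof -
          have "v i < 0"
            using that m by (intro less.IH) auto
          moreover have "u (n - i) * u m < u (m - i) * u n"
            using that m ratio[of "m - i" m] by (simp add: Suc_diff_le)
          ultimately show ?thesis
            by (simp add: mult_less_0_iff)
        qed
        then show ?thesis
          using Suc by (intro sum_strict_mono[where g = "\<lambda>_. 0", simplified]) auto
      qed
      finally show ?thesis
        using pos[of 0] pos[of m] by (simp add: mult_less_0_iff not_less_iff_gr_or_eq)
    qed
  qed
  then show ?thesis
    by (simp add: v_def)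
qed

section \<open>The logarithmic series and its Gregory coefficients\<close>

definition log_quot_fps :: "'a :: field_char_0 fps" where
  "log_quot_fps = Abs_fps (\<lambda>n. 1 / of_nat (Suc n))"

text \<open>
  With \<open>G\<^sub>n\<close> the Gregory coefficients, \<open>1 / g = 1 - \<Sum> |G\<^sub>n| t\<^sup>n\<close>, so the following series is
  \<open>\<Sum> (n + 1) |G\<^sub>n\<^sub>+\<^sub>1| t\<^sup>n\<close>. It lives over the rationals because rationality of the coefficients is
  part of the claim; it is carried to the complex numbers coefficientwise.
\<close>

definition gregory_fps :: "rat fps" where
  "gregory_fps = - fps_deriv (inverse log_quot_fps)"

lemma log_quot_fps_nth_0 [simp]: "fps_nth log_quot_fps 0 = 1"
  by (simp add: log_quot_fps_def)

lemma gregory_fps_pos: "fps_nth gregory_fps n > 0"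
proof -
  define u where "u = (\<lambda>n. 1 / (of_nat (Suc n) :: rat))"
  have "fps_nth (inverse (Abs_fps u)) (Suc n) < 0"
  proof (rule inverse_fps_nth_neg_of_log_convex)
    show "u n > 0" for n
      by (simp add: u_def)
    show "u (Suc n) * u (Suc n) < u n * u (Suc (Suc n))" for n
    proof -
      define a where "a = (of_nat n :: rat)"
      have "a \<ge> 0"
        by (simp add: a_def)
      then have "1 / ((a + 2) * (a + 2)) < 1 / ((a + 1) * (a + 3))"
        by (intro divide_strict_left_mono mult_pos_pos) (auto simp: algebra_simps)
      then show ?thesis
        by (simp add: u_def a_def add_ac)
    qed
  qed auto
  then have "of_nat (Suc n) * fps_nth (inverse (Abs_fps u)) (Suc n) < 0"
    by (simp add: mult_less_0_iff del: of_nat_Suc)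
  then show ?thesis
    by (simp add: gregory_fps_def log_quot_fps_def u_def)
qed

lemma fps_deriv_log_quot_fps:
  "fps_deriv log_quot_fps = gregory_fps * log_quot_fps * log_quot_fps"
proof -
  have inv: "inverse log_quot_fps * log_quot_fps = (1 :: rat fps)"
    by (intro inverse_mult_eq_1) simp
  have "gregory_fps = fps_deriv log_quot_fps * (inverse log_quot_fps)\<^sup>2"
    unfolding gregory_fps_def by (subst fps_inverse_deriv) auto
  then have "gregory_fps * log_quot_fps * log_quot_fps
      = fps_deriv log_quot_fps * (inverse log_quot_fps * log_quot_fps)\<^sup>2"
    by (simp add: power2_eq_square algebra_simps)
  then show ?thesis
    by (simp add: inv)
qed

definition fps_of_rat :: "rat fps \<Rightarrow> complex fps" where
  "fps_of_rat F = Abs_fps (\<lambda>n. of_rat (fps_nth F n))"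

lemma fps_of_rat_nth [simp]: "fps_nth (fps_of_rat F) n = of_rat (fps_nth F n)"
  by (simp add: fps_of_rat_def)

lemma fps_of_rat_mult: "fps_of_rat (F * G) = fps_of_rat F * fps_of_rat G"
  by (simp add: fps_eq_iff fps_mult_nth of_rat_sum of_rat_mult)

lemma fps_of_rat_deriv: "fps_of_rat (fps_deriv F) = fps_deriv (fps_of_rat F)"
  by (simp add: fps_eq_iff of_rat_mult of_rat_add)

lemma fps_of_rat_log_quot_fps: "fps_of_rat log_quot_fps = log_quot_fps"
  by (simp add: fps_eq_iff log_quot_fps_def of_rat_divide of_rat_add)

lemma log_quot_sums:
  assumes "norm t < 1"
  shows "(\<lambda>n. fps_nth log_quot_fps n * t ^ n) sums log_quot t"
proof (cases "t = 0")
  case True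
  then show ?thesis
    using powser_sums_zero[of "fps_nth (log_quot_fps :: complex fps)"] by (simp add: log_quot_def)
next
  case False
  have "(\<lambda>n. (-1) ^ Suc n / of_nat n * (-t) ^ n) sums Ln (1 + -t)"
    using assms by (intro Ln_series) simp
  then have "(\<lambda>n. (-1) ^ Suc (Suc n) / of_nat (Suc n) * (-t) ^ Suc n) sums Ln (1 - t)"
    by (subst sums_Suc_iff) simp
  then have "(\<lambda>n. ((-1) ^ Suc (Suc n) / of_nat (Suc n) * (-t) ^ Suc n) * (- 1 / t))
      sums (Ln (1 - t) * (- 1 / t))"
    by (rule sums_mult2)
  moreover have "((-1) ^ Suc (Suc n) / of_nat (Suc n) * (-t) ^ Suc n) * (- 1 / t)
      = fps_nth log_quot_fps n * t ^ n" for n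
  proof -
    have "(-t) ^ Suc n = (-1) ^ Suc n * t ^ Suc n"
      by (metis mult_minus1 power_mult_distrib)
    then show ?thesis
      using False by (simp add: log_quot_fps_def field_simps flip: power_add)
  qed
  ultimately show ?thesis
    using False by (simp add: log_quot_def)
qed

lemma eventually_in_unit_ball: "eventually (\<lambda>t. t \<in> ball 0 1) (nhds (0 :: complex))"
  by (intro eventually_nhds_in_open) auto

lemma log_quot_has_fps_expansion: "log_quot has_fps_expansion log_quot_fps"
  by (rule has_fps_expansionI, rule eventually_mono[OF eventually_in_unit_ball])
     (auto intro: log_quot_sums)

section \<open>Differential equations for the generating function\<close>

definition alpha_fps :: "complex \<Rightarrow> complex fps" where
  "alpha_fps s = Abs_fps (\<lambda>k. alpha k s)"

lemma alpha_fps_nth [simp]: "fps_nth (alpha_fps s) k = alpha k s"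
  by (simp add: alpha_fps_def)

lemma log_quot_pow_has_fps_expansion: "log_quot_pow s has_fps_expansion alpha_fps s"
  by (rule has_fps_expansionI, rule eventually_mono[OF eventually_in_unit_ball])
     (auto intro: alpha_taylor_expansion)

lemma exp_log_branch: "t \<in> ball 0 1 \<Longrightarrow> exp (log_branch t) = log_quot t"
  using is_log_branch_log_branch by (auto simp: is_log_branch_def)

lemma log_branch_0 [simp]: "log_branch 0 = 0"
  using is_log_branch_log_branch by (auto simp: is_log_branch_def)

text \<open>
  The identities \<open>g\<^sup>s = g\<^sup>s\<^sup>-\<^sup>1 g\<close> and \<open>(g\<^sup>s)' = s g\<^sup>s\<^sup>-\<^sup>1 g'\<close> hold on the whole disc and
  hence between Taylor series at \<open>0\<close>; all recurrences for the coefficients are extracted from them.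
\<close>

lemma log_quot_pow_shift:
  assumes "t \<in> ball 0 1"
  shows "log_quot_pow (s + 1) t = log_quot_pow s t * log_quot t"
proof -
  have "s * log_branch t = (s - 1) * log_branch t + log_branch t"
    by (simp add: algebra_simps)
  then show ?thesis
    by (simp add: log_quot_pow_def exp_log_branch[OF assms, symmetric] flip: exp_add)
qed

lemma deriv_log_quot_pow_shift:
  assumes t: "t \<in> ball 0 1"
  shows "deriv (log_quot_pow (s + 1)) t = s * log_quot_pow s t * deriv log_quot t"
proof -
  have L: "(log_branch has_field_derivative deriv log_branch t) (at t)"
    using is_log_branch_log_branch t by (auto simp: is_log_branch_def intro: holomorphic_derivI)
  have "((\<lambda>t. exp (log_branch t)) has_field_derivative (log_quot t * deriv log_branch t)) (at t)"
    using DERIV_chain2[OF DERIV_exp L] by (simp add: exp_log_branch[OF t])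
  then have "(log_quot has_field_derivative (log_quot t * deriv log_branch t)) (at t)"
    by (rule has_field_derivative_transform_within_open[of _ _ _ "ball 0 1"])
       (use t exp_log_branch in auto)
  then have dg: "deriv log_quot t = log_quot t * deriv log_branch t"
    by (rule DERIV_imp_deriv)
  have "(log_quot_pow (s + 1) has_field_derivative
      (exp (s * log_branch t) * (s * deriv log_branch t))) (at t)"
    unfolding log_quot_pow_def by (auto intro!: derivative_eq_intros L)
  then have "deriv (log_quot_pow (s + 1)) t = log_quot_pow (s + 1) t * (s * deriv log_branch t)"
    by (intro DERIV_imp_deriv) (simp add: log_quot_pow_def)
  then show ?thesis
    by (simp add: dg log_quot_pow_shift[OF t])
qed

lemma alpha_fps_shift: "alpha_fps (s + 1) = alpha_fps s * log_quot_fps"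
proof -
  have "(\<lambda>t. log_quot_pow s t * log_quot t) has_fps_expansion alpha_fps s * log_quot_fps"
    by (intro has_fps_expansion_mult log_quot_pow_has_fps_expansion log_quot_has_fps_expansion)
  also have "?this \<longleftrightarrow> log_quot_pow (s + 1) has_fps_expansion alpha_fps s * log_quot_fps"
    by (intro has_fps_expansion_cong refl eventually_mono[OF eventually_in_unit_ball])
       (simp add: log_quot_pow_shift)
  finally show ?thesis
    using log_quot_pow_has_fps_expansion fps_expansion_unique_complex by blast
qed

lemma deriv_alpha_fps_shift:
  "fps_deriv (alpha_fps (s + 1)) = fps_const s * alpha_fps s * fps_deriv log_quot_fps"
proof -
  have "(\<lambda>t. s * log_quot_pow s t * deriv log_quot t)
      has_fps_expansion fps_const s * alpha_fps s * fps_deriv log_quot_fps"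
    by (intro fps_expansion_intros log_quot_pow_has_fps_expansion log_quot_has_fps_expansion)
  also have "?this \<longleftrightarrow> deriv (log_quot_pow (s + 1))
      has_fps_expansion fps_const s * alpha_fps s * fps_deriv log_quot_fps"
    by (intro has_fps_expansion_cong refl eventually_mono[OF eventually_in_unit_ball])
       (simp add: deriv_log_quot_pow_shift)
  finally show ?thesis
    using has_fps_expansion_deriv[OF log_quot_pow_has_fps_expansion] fps_expansion_unique_complex
    by blast
qed

text \<open>
  Raising the parameter from \<open>s - 1\<close> to \<open>s + 1\<close> absorbs the two factors \<open>g\<close> in
  \<open>g' = D g\<^sup>2\<close>. This leaves only the series \<open>D\<close>, whose coefficients are positive.
\<close>

lemma deriv_alpha_fps:
  "fps_deriv (alpha_fps s) = fps_const (s - 1) * (alpha_fps (s + 1) * fps_of_rat gregory_fps)"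
proof -
  have "fps_deriv log_quot_fps = fps_of_rat gregory_fps * log_quot_fps * log_quot_fps"
    by (metis fps_deriv_log_quot_fps fps_of_rat_mult fps_of_rat_deriv fps_of_rat_log_quot_fps)
  then show ?thesis
    using deriv_alpha_fps_shift[of "s - 1"] alpha_fps_shift[of "s - 1"] alpha_fps_shift[of s]
    by (simp add: algebra_simps)
qed

lemma alpha_0 [simp]: "alpha 0 s = 1"
  by (simp add: alpha_def log_quot_pow_def)

lemma alpha_Suc_conv_shift:
  "of_nat (Suc k) * alpha (Suc k) s
     = (s - 1) * (\<Sum>j=0..k. alpha j (s + 1) * of_rat (fps_nth gregory_fps (k - j)))"
  using arg_cong[OF deriv_alpha_fps[of s], of "\<lambda>F. fps_nth F k",
      unfolded fps_mult_left_const_nth]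
  by (simp add: fps_mult_nth)

lemma alpha_Suc_shift:
  "of_nat (Suc k) * alpha (Suc k) (s + 1)
     = s * (\<Sum>j=0..k. alpha j (s + 1)
         * of_rat (fps_nth (gregory_fps * log_quot_fps) (k - j)))"
proof -
  have "fps_deriv (alpha_fps (s + 1))
      = fps_const s * (alpha_fps (s + 1) * fps_of_rat (gregory_fps * log_quot_fps))"
    using deriv_alpha_fps[of "s + 1"] alpha_fps_shift[of "s + 1"]
    by (simp add: fps_of_rat_mult fps_of_rat_log_quot_fps algebra_simps)
  from arg_cong[OF this, of "\<lambda>F. fps_nth F k", unfolded fps_mult_left_const_nth] show ?thesis
    unfolding fps_mult_nth[of "alpha_fps (s + 1)"] by simp
qed

text \<open>
  This is the coefficient of \<open>t\<^sup>k\<close> in \<open>(t g\<^sup>s)' = g\<^sup>s\<^sup>-\<^sup>1 (g + s t g')\<close>, obtained by adding the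
  coefficients of \<open>g\<^sup>s\<close> and of \<open>t (g\<^sup>s)'\<close>. The weights stay bounded by \<open>s\<close> for real
  \<open>s \<ge> 1\<close>, which is what produces the factor \<open>1 / (k + 1)\<close> in the final estimate.
\<close>

lemma alpha_shift_weighted:
  "of_nat (Suc k) * alpha k (s + 1)
     = (\<Sum>j=0..k. alpha j s * ((1 + s * of_nat (k - j)) / of_nat (Suc (k - j))))"
proof -
  have k: "of_nat k * alpha k (s + 1)
      = (\<Sum>j=0..k. alpha j s * (s * of_nat (k - j) / of_nat (Suc (k - j))))"
  proof (cases k)
    case (Suc m)
    have "of_nat (Suc m) * alpha (Suc m) (s + 1)
        = s * (\<Sum>j=0..m. alpha j s * (of_nat (Suc (m - j)) / of_nat (Suc (Suc (m - j)))))"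
      using arg_cong[OF deriv_alpha_fps_shift[of s], of "\<lambda>F. fps_nth F m",
          unfolded mult.assoc fps_mult_left_const_nth]
      by (simp add: fps_mult_nth log_quot_fps_def del: of_nat_Suc of_nat_diff)
    also have "\<dots> = (\<Sum>j=0..Suc m. alpha j s * (s * of_nat (Suc m - j) / of_nat (Suc (Suc m - j))))"
      by (simp add: sum_distrib_left mult_ac Suc_diff_le del: of_nat_Suc of_nat_diff)
    finally show ?thesis
      by (simp add: Suc)
  qed simp
  have "alpha k (s + 1) = (\<Sum>j=0..k. alpha j s * (1 / of_nat (Suc (k - j))))"
    using arg_cong[OF alpha_fps_shift[of s], of "\<lambda>F. fps_nth F k"]
    by (simp add: fps_mult_nth log_quot_fps_def)
  with k have "of_nat (Suc k) * alpha k (s + 1)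
      = (\<Sum>j=0..k. alpha j s * (1 / of_nat (Suc (k - j))))
        + (\<Sum>j=0..k. alpha j s * (s * of_nat (k - j) / of_nat (Suc (k - j))))"
    by (simp add: algebra_simps)
  also have "\<dots> = (\<Sum>j=0..k. alpha j s * ((1 + s * of_nat (k - j)) / of_nat (Suc (k - j))))"
    by (simp add: add_divide_distrib distrib_left flip: sum.distrib)
  finally show ?thesis .
qed

section \<open>Rational polynomials with nonnegative coefficients\<close>

lemma poly_map_of_rat_altdef:
  "poly (map_poly of_rat p) x = (\<Sum>i\<le>degree p. of_rat (coeff p i) * x ^ i)"
  for x :: "'a :: field_char_0"
  by (simp add: poly_altdef coeff_map_poly degree_map_poly)

lemma poly_map_of_rat_sum_smult:
  "poly (map_poly of_rat (\<Sum>j\<in>A. smult (c j) (q j))) x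
     = (\<Sum>j\<in>A. of_rat (c j) * poly (map_poly of_rat (q j)) x)"
  for x :: "'a :: field_char_0"
proof -
  have add: "map_poly of_rat (p + q) = (map_poly of_rat p + map_poly of_rat q :: 'a poly)" for p q
    by (intro poly_eqI) (simp add: coeff_map_poly of_rat_add)
  show ?thesis
    by (induction A rule: infinite_finite_induct) (simp_all add: add map_poly_smult of_rat_mult)
qed

lemma complex_of_real_of_rat: "complex_of_real (of_rat c) = of_rat c"
  by (cases c) (simp add: of_rat_rat)

lemma norm_poly_le_poly_norm:
  fixes z :: complex
  assumes "\<And>i. coeff p i \<ge> 0"
  shows "norm (poly (map_poly of_rat p) z) \<le> poly (map_poly of_rat p) (norm z)"
proof -
  have "norm (of_rat (coeff p i) * z ^ i) = of_rat (coeff p i) * norm z ^ i" for i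
    using assms[of i] norm_of_real[of "of_rat (coeff p i)", where 'a = complex]
    by (simp add: norm_mult norm_power complex_of_real_of_rat)
  then show ?thesis
    unfolding poly_map_of_rat_altdef by (intro order.trans[OF norm_sum]) simp
qed

lemma poly_map_of_rat_mono:
  fixes x y :: real
  assumes "\<And>i. coeff p i \<ge> 0" "0 \<le> x" "x \<le> y"
  shows "poly (map_poly of_rat p) x \<le> poly (map_poly of_rat p) y"
  unfolding poly_map_of_rat_altdef
  using assms by (intro sum_mono mult_left_mono power_mono) auto

lemma poly_map_of_rat_nonneg:
  fixes x :: real
  assumes "\<And>i. coeff p i \<ge> 0" "0 \<le> x"
  shows "poly (map_poly of_rat p) x \<ge> 0"
  unfolding poly_map_of_rat_altdef using assms by (intro sum_nonneg mult_nonneg_nonneg) auto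

lemma poly_map_of_rat_of_real:
  "poly (map_poly of_rat p) (complex_of_real x) = of_real (poly (map_poly of_rat p) x)"
  unfolding poly_map_of_rat_altdef by (simp add: complex_of_real_of_rat)

section \<open>Positivity of the coefficient polynomials\<close>

lemma coeff_sum_smult_pos:
  fixes c :: "nat \<Rightarrow> 'a :: linordered_field"
  assumes c: "\<And>j. c j > 0" and Q: "\<And>j. j \<le> k \<Longrightarrow> coeff (Q j) m \<ge> 0" and "m \<le> k" "coeff (Q m) m > 0"
  shows "coeff (\<Sum>j=0..k. smult (c j) (Q j)) m > 0"
proof -
  have "(\<Sum>j=0..k. c j * coeff (Q j) m) > 0"
    using assms by (intro sum_pos2[of _ m]) (auto simp: less_imp_le)
  then show ?thesis by (simp add: coeff_sum)
qed

text \<open>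
  The recurrence \<open>alpha_Suc_shift\<close> has positive weights and multiplies by \<open>s\<close> at each step, so
  nonnegativity is preserved and the degree grows by at most one. The leading coefficient at
  \<open>m + 1\<close> comes from that at \<open>m\<close> alone.
\<close>

lemma alpha_shift_poly_exists:
  "\<exists>q :: rat poly. degree q \<le> k \<and> (\<forall>i. coeff q i \<ge> 0) \<and> coeff q k > 0 \<and>
     (\<forall>s :: complex. alpha k (s + 1) = poly (map_poly of_rat q) s)"
proof (induction k rule: less_induct)
  case (less k)
  show ?case
  proof (cases k)
    case 0
    then show ?thesis
      by (intro exI[of _ 1]) simp
  next
    case (Suc m)
    define c where "c = (\<lambda>j. fps_nth (gregory_fps * log_quot_fps) (m - j))"
    have c: "c j > 0" for j
      unfolding c_def fps_mult_nth log_quot_fps_def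
      by (intro sum_pos)
         (auto intro!: divide_pos_pos gregory_fps_pos simp: add_pos_nonneg simp del: of_nat_diff)
    have "\<forall>j\<in>{0..m}. \<exists>q :: rat poly. degree q \<le> j \<and> (\<forall>i. coeff q i \<ge> 0) \<and> coeff q j > 0 \<and>
        (\<forall>s :: complex. alpha j (s + 1) = poly (map_poly of_rat q) s)"
      using less.IH by (simp add: Suc)
    then obtain Q :: "nat \<Rightarrow> rat poly"
      where Q: "\<forall>j\<in>{0..m}. degree (Q j) \<le> j \<and> (\<forall>i. coeff (Q j) i \<ge> 0) \<and> coeff (Q j) j > 0 \<and>
        (\<forall>s :: complex. alpha j (s + 1) = poly (map_poly of_rat (Q j)) s)"
      by metis
    define P where "P = (\<Sum>j=0..m. smult (c j) (Q j))"
    define q where "q = smult (1 / of_nat (Suc m)) (pCons 0 P)"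
    have "degree P \<le> m"
      unfolding P_def using Q
      by (intro degree_sum_le order.trans[OF degree_smult_le]) (auto intro: order.trans)
    then have "degree q \<le> k"
      unfolding q_def Suc
      by (intro order.trans[OF degree_smult_le] order.trans[OF degree_pCons_le]) simp
    moreover have "coeff q i \<ge> 0" for i
      using Q c unfolding q_def P_def
      by (auto simp: coeff_pCons coeff_sum split: nat.split intro!: sum_nonneg mult_nonneg_nonneg
          divide_nonneg_nonneg less_imp_le[OF c])
    moreover have "coeff q k > 0"
    proof -
      have "coeff P m > 0"
        unfolding P_def using Q c by (intro coeff_sum_smult_pos) auto
      then show ?thesis
        by (simp add: q_def Suc add_pos_nonneg)
    qed
    moreover have "alpha k (s + 1) = poly (map_poly of_rat q) s" for s :: complex
    proof -
      have "poly (map_poly of_rat P) s = (\<Sum>j=0..m. alpha j (s + 1) * of_rat (c j))"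
        unfolding P_def poly_map_of_rat_sum_smult using Q by (intro sum.cong) simp_all
      then have "of_nat (Suc m) * alpha k (s + 1) = s * poly (map_poly of_rat P) s"
        using alpha_Suc_shift[of m s] by (simp add: Suc c_def)
      moreover have "poly (map_poly of_rat q) s
          = s * poly (map_poly of_rat P) s / of_nat (Suc m)"
        by (simp add: q_def map_poly_smult map_poly_pCons of_rat_mult of_rat_divide of_rat_add)
      ultimately show ?thesis
        by (metis nonzero_mult_div_cancel_left of_nat_neq_0)
    qed
    ultimately show ?thesis by blast
  qed
qed

text \<open>
  The polynomial \<open>Q j\<close> for \<open>\<alpha>\<^sub>j(s + 1)\<close> has a positive coefficient at \<open>s\<^sup>j\<close>. Summing the
  \<open>Q j\<close> over all \<open>j < k\<close> with positive weights therefore leaves no gap below degree \<open>k\<close>.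
\<close>

lemma alpha_quotient_poly_exists:
  assumes "k \<ge> 1"
  shows "\<exists>p :: rat poly. p \<noteq> 0 \<and> (\<forall>i\<le>degree p. coeff p i > 0) \<and>
           (\<forall>s :: complex. alpha k s = (s - 1) * poly (map_poly of_rat p) s)"
proof -
  obtain m where m: "k = Suc m"
    using assms by (cases k) auto
  obtain Q :: "nat \<Rightarrow> rat poly"
    where Q: "\<And>j. degree (Q j) \<le> j" "\<And>i j. coeff (Q j) i \<ge> 0" "\<And>j. coeff (Q j) j > 0"
      "\<And>j s. alpha j (s + 1) = poly (map_poly of_rat (Q j)) s"
    using alpha_shift_poly_exists by metis
  define c where "c = (\<lambda>j. fps_nth gregory_fps (m - j) / of_nat (Suc m))"
  define p where "p = (\<Sum>j=0..m. smult (c j) (Q j))"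
  have c: "c j > 0" for j
    unfolding c_def by (intro divide_pos_pos gregory_fps_pos) (simp add: add_pos_nonneg)
  have deg: "degree p \<le> m"
    unfolding p_def using Q(1)
    by (intro degree_sum_le order.trans[OF degree_smult_le]) (auto intro: order.trans)
  have pos: "coeff p i > 0" if "i \<le> m" for i
    unfolding p_def using Q c that by (intro coeff_sum_smult_pos) auto
  have "alpha k s = (s - 1) * poly (map_poly of_rat p) s" for s
  proof -
    have "poly (map_poly of_rat p) s
        = (\<Sum>j=0..m. alpha j (s + 1) * of_rat (fps_nth gregory_fps (m - j))) / of_nat (Suc m)"
      unfolding p_def poly_map_of_rat_sum_smult sum_divide_distrib
      by (intro sum.cong) (simp_all add: Q(4) c_def of_rat_divide of_rat_add)
    then have "(s - 1) * poly (map_poly of_rat p) s = of_nat (Suc m) * alpha k s / of_nat (Suc m)"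
      using alpha_Suc_conv_shift[of m s] by (simp add: m)
    then show ?thesis
      by (simp del: of_nat_Suc)
  qed
  moreover have "p \<noteq> 0"
    using pos[of 0] by auto
  ultimately show ?thesis
    using pos deg by (intro exI[of _ p]) auto
qed

section \<open>Growth of the coefficients at real parameters\<close>

lemma alpha_of_real_nonneg:
  assumes "y \<ge> 1"
  shows "alpha k (of_real y) = of_real (norm (alpha k (of_real y)))"
proof -
  obtain q :: "rat poly" where q: "\<And>i. coeff q i \<ge> 0"
    "\<And>s. alpha k (s + 1) = poly (map_poly of_rat q) s"
    using alpha_shift_poly_exists[of k] by blast
  have "alpha k (of_real y) = of_real (poly (map_poly of_rat q) (y - 1))"
    using q(2)[of "of_real (y - 1)"] by (simp add: poly_map_of_rat_of_real[symmetric])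
  moreover have "poly (map_poly of_rat q) (y - 1) \<ge> 0"
    using assms q by (intro poly_map_of_rat_nonneg) auto
  ultimately show ?thesis by simp
qed

lemma norm_log_quot_pow_of_real:
  assumes "0 < r" "r < 1"
  shows "norm (log_quot_pow (of_real y) (of_real r)) = (- ln (1 - r) / r) powr (y - 1)"
proof -
  have r: "complex_of_real r \<in> ball 0 1"
    using assms by simp
  have "Ln (1 - of_real r) = of_real (ln (1 - r))"
    using assms Ln_of_real[of "1 - r"] by simp
  then have "norm (log_quot (of_real r)) = - ln (1 - r) / r"
    using assms by (simp add: log_quot_def norm_divide)
  then have "exp (Re (log_branch (of_real r))) = - ln (1 - r) / r"
    using exp_log_branch[OF r] norm_exp_eq_Re by metis
  moreover have "exp (Re (log_branch (of_real r))) powr (y - 1)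
      = norm (log_quot_pow (of_real y) (of_real r))"
    by (simp add: log_quot_pow_def powr_def)
  ultimately show ?thesis by simp
qed

text \<open>
  A partial sum of a series with nonnegative coefficients is controlled by the value at any
  \<open>r < 1\<close>, since \<open>r\<^sup>k \<le> r\<^sup>j\<close> for \<open>j \<le> k\<close>. Taking \<open>1 - r = 1 / (k + 1)\<close> keeps \<open>r\<^sup>-\<^sup>k\<close>
  below \<open>e\<close> while \<open>g(r)\<close> is only logarithmic in \<open>k\<close>.
\<close>

lemma sum_alpha_le:
  assumes y: "y \<ge> 1" and k: "k \<ge> 1"
  shows "(\<Sum>j=0..k. norm (alpha j (of_real y))) \<le> exp 1 * (2 * ln (real k + 1)) powr (y - 1)"
proof -
  define r where "r = real k / (real k + 1)"
  have r: "0 < r" "r < 1"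
    using k by (auto simp: r_def)
  define S where "S = (\<Sum>j=0..k. norm (alpha j (of_real y)))"
  have "(\<lambda>j. alpha j (of_real y) * of_real r ^ j) sums log_quot_pow (of_real y) (of_real r)"
    using r by (intro alpha_taylor_expansion) simp
  then have "(\<lambda>j. complex_of_real (norm (alpha j (of_real y)) * r ^ j))
      sums log_quot_pow (of_real y) (of_real r)"
    by (simp add: alpha_of_real_nonneg[OF y, symmetric])
  then have sums: "(\<lambda>j. norm (alpha j (of_real y)) * r ^ j)
      sums Re (log_quot_pow (of_real y) (of_real r))"
    using sums_Re by fastforce
  have "S * r ^ k \<le> (\<Sum>j=0..k. norm (alpha j (of_real y)) * r ^ j)"
    unfolding S_def sum_distrib_right using r
    by (intro sum_mono mult_left_mono power_decreasing) auto
  also have "\<dots> \<le> Re (log_quot_pow (of_real y) (of_real r))"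
    using r by (intro sum_le_suminf[of "\<lambda>j. norm (alpha j (of_real y)) * r ^ j" "{0..k}",
          unfolded sums_unique[OF sums, symmetric]] sums_summable[OF sums]) auto
  also have "\<dots> \<le> (- ln (1 - r) / r) powr (y - 1)"
    using complex_Re_le_cmod norm_log_quot_pow_of_real[OF r] by metis
  also have "\<dots> \<le> (2 * ln (real k + 1)) powr (y - 1)"
  proof (intro powr_mono2)
    have "1 - r = 1 / (real k + 1)"
      by (simp add: r_def field_simps)
    then have "- ln (1 - r) = ln (real k + 1)"
      by (simp add: ln_div)
    moreover have "ln (real k + 1) / r \<le> 2 * ln (real k + 1)"
    proof -
      have "1 / r \<le> 2"
        using k by (simp add: r_def field_simps)
      from mult_right_mono[OF this, of "ln (real k + 1)"] show ?thesis
        by simp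
    qed
    ultimately show "- ln (1 - r) / r \<le> 2 * ln (real k + 1)" "0 \<le> - ln (1 - r) / r"
      using r by simp_all
  qed (use y in auto)
  finally have le: "S * r ^ k \<le> (2 * ln (real k + 1)) powr (y - 1)" .
  have "(1 / r) ^ k \<le> exp 1"
  proof -
    have "1 / r = 1 + 1 / real k"
      using k by (simp add: r_def field_simps)
    then have "(1 / r) ^ k \<le> exp (1 / real k) ^ k"
      by (intro power_mono) (use exp_ge_add_one_self r in auto)
    also have "\<dots> = exp 1"
      using k by (simp flip: exp_of_nat_mult)
    finally show ?thesis .
  qed
  then have "S * r ^ k * (1 / r) ^ k \<le> (2 * ln (real k + 1)) powr (y - 1) * exp 1"
    using le r by (intro mult_mono) auto
  moreover have "S * r ^ k * (1 / r) ^ k = S"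
    using r by (simp add: power_divide)
  ultimately show ?thesis
    unfolding S_def by (simp only: mult.commute)
qed

text \<open>
  The bound \<open>(2 log (k + 1))\<^sup>y\<^sup>-\<^sup>1\<close> of the partial sum has exponent \<open>y - 1\<close>; the missing factor
  \<open>2 (1 + log (k + 1))\<close> of the claimed bound is used to absorb the constant \<open>e\<close>.
\<close>

lemma norm_alpha_of_real_le:
  assumes y: "y \<ge> 1" and k: "k \<ge> 1"
  shows "norm (alpha k (of_real (y + 1)))
    \<le> (y + 1) * 2 powr y * (1 + ln (real k + 1)) powr y / (real k + 1)"
proof -
  have "real (Suc k) * norm (alpha k (of_real (y + 1)))
      = norm (of_nat (Suc k) * alpha k (of_real y + 1))"
    by (simp only: norm_mult norm_of_nat of_real_add of_real_1)
  also have "\<dots> \<le> (\<Sum>j=0..k. norm (alpha j (of_real y)) * y)"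
    unfolding alpha_shift_weighted
  proof (rule order.trans[OF norm_sum sum_mono])
    fix j
    have "norm ((1 + of_real y * of_nat (k - j)) / of_nat (Suc (k - j)) :: complex)
        = norm (complex_of_real ((1 + y * real (k - j)) / real (Suc (k - j))))"
      by (simp del: of_nat_Suc)
    also have "\<dots> = (1 + y * real (k - j)) / real (Suc (k - j))"
      unfolding norm_of_real using y by (intro abs_of_nonneg) auto
    also have "\<dots> \<le> y"
      using y by (simp add: field_simps)
    finally show "norm (alpha j (of_real y)
          * ((1 + of_real y * of_nat (k - j)) / of_nat (Suc (k - j))))
        \<le> norm (alpha j (of_real y)) * y"
      unfolding norm_mult by (intro mult_left_mono) auto
  qed
  also have "\<dots> = y * (\<Sum>j=0..k. norm (alpha j (of_real y)))"
    by (simp add: sum_distrib_left mult.commute)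
  also have "\<dots> \<le> (y + 1) * ((2 * (1 + ln (real k + 1))) * (2 * (1 + ln (real k + 1))) powr (y - 1))"
  proof (intro mult_mono order.trans[OF sum_alpha_le[OF y k]] powr_mono2)
    have "ln 2 \<le> ln (real k + 1)"
      using k by (subst ln_le_cancel_iff) auto
    then show "exp 1 \<le> 2 * (1 + ln (real k + 1))"
      using e_less_272 ln2_ge_two_thirds unfolding distrib_left by linarith
  qed (use y in \<open>auto intro!: sum_nonneg\<close>)
  also have "\<dots> = (y + 1) * (2 * (1 + ln (real k + 1))) powr y"
    using powr_add[of "2 * (1 + ln (real k + 1))" 1 "y - 1"] by (simp add: add_pos_nonneg)
  also have "\<dots> = (y + 1) * 2 powr y * (1 + ln (real k + 1)) powr y"
    by (subst powr_mult) auto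
  finally show ?thesis
    by (simp add: field_simps)
qed

section \<open>The structure and the size of the coefficients\<close>

theorem theorem1p1:
  fixes k :: nat
  assumes "k \<ge> 1"
  shows "(\<exists>p :: rat poly. p \<noteq> 0 \<and> (\<forall>i\<le>degree p. coeff p i > 0) \<and>
           (\<forall>s :: complex. alpha k s = (s - 1) * poly (map_poly of_rat p) s)) \<and>
         (\<forall>s :: complex. norm (alpha k s)
            \<le> c_bound s * (1 + ln (real k + 1)) powr (norm s + 1) / (real k + 1))"
proof (intro conjI allI)
  show ex: "\<exists>p :: rat poly. p \<noteq> 0 \<and> (\<forall>i\<le>degree p. coeff p i > 0) \<and>
           (\<forall>s :: complex. alpha k s = (s - 1) * poly (map_poly of_rat p) s)"
    using assms by (rule alpha_quotient_poly_exists)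
  then obtain p :: "rat poly" where pos: "\<And>i. i \<le> degree p \<Longrightarrow> coeff p i > 0"
    and p: "\<And>s. alpha k s = (s - 1) * poly (map_poly of_rat p) s"
    by blast
  have nonneg: "coeff p i \<ge> 0" for i
    using pos[of i] by (cases "i \<le> degree p") (auto simp: coeff_eq_0)
  fix s :: complex
  define x where "x = norm s"
  have x: "x \<ge> 0"
    by (simp add: x_def)
  define B where "B = 2 powr (x + 1) * (1 + ln (real k + 1)) powr (x + 1) / (real k + 1)"
  have "norm (poly (map_poly of_rat p) s) \<le> poly (map_poly of_rat p) x"
    unfolding x_def using nonneg by (rule norm_poly_le_poly_norm)
  \<comment> \<open>The quotient \<open>\<alpha>\<^sub>k(x) / (x - 1)\<close> is of no use near \<open>x = 1\<close>; at \<open>x + 2\<close> the denominator is \<open>x + 1\<close>.\<close>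
  also have "\<dots> \<le> poly (map_poly of_rat p) (x + 2)"
    using nonneg x by (intro poly_map_of_rat_mono) auto
  also have "\<dots> = norm (alpha k (of_real (x + 1 + 1))) / (x + 1)"
  proof -
    have "alpha k (of_real (x + 1 + 1)) = of_real ((x + 1) * poly (map_poly of_rat p) (x + 2))"
      unfolding p poly_map_of_rat_of_real by (simp add: add.assoc)
    moreover have "poly (map_poly of_rat p) (x + 2) \<ge> 0"
      using nonneg x by (intro poly_map_of_rat_nonneg) auto
    ultimately show ?thesis
      using x by (simp only: norm_of_real abs_mult) simp
  qed
  also have "\<dots> \<le> (x + 2) * B / (x + 1)"
    using norm_alpha_of_real_le[of "x + 1" k] assms x
    by (intro divide_right_mono) (simp_all add: B_def algebra_simps)
  finally have "norm (s - 1) * norm (poly (map_poly of_rat p) s)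
      \<le> norm (s - 1) * ((x + 2) * B / (x + 1))"
    by (intro mult_left_mono) auto
  then show "norm (alpha k s)
      \<le> c_bound s * (1 + ln (real k + 1)) powr (norm s + 1) / (real k + 1)"
    by (simp add: p norm_mult c_bound_def B_def x_def mult_ac)
qed

end
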